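(* Let $\mathbb{F}$ be a field whose characteristic is not $2$, let $n\geq 1$, and let $A\in \mathrm{Mat}_n(\mathbb{F})$. A matrix $\Lambda=\begin{bmatrix} p&q\\ r&s\end{bmatrix}\in \mathrm{Mat}_2(\mathbb{F})$ is a proper super-eigenvalue of $A$ if and only if $\det(p_{\Lambda}(A))=0$ and the polynomial $p_{\Lambda}(T)$ is irreducible over $\mathbb{F}$.
   Context: Let $\mathbb{F}$ be a field and $A\in \mathrm{Mat}_n(\mathbb{F})$, acting on column vectors in $\mathbb{F}^n$. A super-eigenvector of $A$ is a $2$-dimensional $A$-invariant subspace $W\subseteq \mathbb{F}^n$. It is called proper if it contains no eigenvector of $A$. If $W=\langle \mathbf{u},\mathbf{v}\rangle$ is a super-eigenvector with basis $\mathbf{u},\mathbf{v}$ and $A\mathbf{u}=p\mathbf{u}+q\mathbf{v}$, $A\mathbf{v}=r\mathbf{u}+s\mathbf{v}$ with $p,q,r,s\in\mathbb{F}$, then $\Lambda=\begin{bmatrix} p&q\\ r&s\end{bmatrix}$ is called a super-eigenvalue of $A$ corresponding to $W$. A super-eigenvalue $\Lambda$ is called proper if it corresponds to a proper super-eigenvector. The polynomial $p_{\Lambda}(T)=(T-p)(T-s)-qr=T^2-\mathrm{tr}(\Lambda)T+\det(\Lambda)\in\mathbb{F}[T]$ is the characteristic polynomial of $\Lambda$, and $p_\Lambda(A)=(A-pI_n)(A-sI_n)-qrI_n$. *)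

theory Defs
  imports
    "HOL-Analysis.Analysis"
    "HOL-Computational_Algebra.Polynomial_Factorial"
begin

definition eigenvector :: "'a::field ^ 'n ^ 'n \<Rightarrow> 'a ^ 'n \<Rightarrow> bool" where
  "eigenvector A v \<longleftrightarrow> v \<noteq> 0 \<and> (\<exists>c. A *v v = c *s v)"

definition super_eigenvector :: "'a::field ^ 'n ^ 'n \<Rightarrow> ('a ^ 'n) set \<Rightarrow> bool" where
  "super_eigenvector A W \<longleftrightarrow>
     vec.subspace W \<and> vec.dim W = 2 \<and> (\<forall>w\<in>W. A *v w \<in> W)"

definition proper_super_eigenvector :: "'a::field ^ 'n ^ 'n \<Rightarrow> ('a ^ 'n) set \<Rightarrow> bool" where
  "proper_super_eigenvector A W \<longleftrightarrow>
     super_eigenvector A W \<and> (\<forall>w\<in>W. \<not> eigenvector A w)"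

definition super_eigenvalue_of ::
    "'a::field ^ 'n ^ 'n \<Rightarrow> ('a ^ 'n) set \<Rightarrow> 'a ^ 2 ^ 2 \<Rightarrow> bool" where
  "super_eigenvalue_of A W L \<longleftrightarrow>
     super_eigenvector A W \<and>
     (\<exists>u v. u \<noteq> v \<and> vec.independent {u, v} \<and> vec.span {u, v} = W \<and>
        A *v u = L$1$1 *s u + L$1$2 *s v \<and>
        A *v v = L$2$1 *s u + L$2$2 *s v)"

definition proper_super_eigenvalue :: "'a::field ^ 'n ^ 'n \<Rightarrow> 'a ^ 2 ^ 2 \<Rightarrow> bool" where
  "proper_super_eigenvalue A L \<longleftrightarrow>
     (\<exists>W. proper_super_eigenvector A W \<and> super_eigenvalue_of A W L)"

text \<open>The characteristic polynomial \<open>(T - p)(T - s) - qr\<close> of a \<open>2 \<times> 2\<close> matrix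
  with rows \<open>(p, q)\<close> and \<open>(r, s)\<close>.\<close>

definition charpoly2 :: "'a::field ^ 2 ^ 2 \<Rightarrow> 'a poly" where
  "charpoly2 L = [:- (L$1$1), 1:] * [:- (L$2$2), 1:] - [:L$1$2 * L$2$1:]"

lemma charpoly2_trace_det: "charpoly2 L = [:det L, - trace L, 1:]"
  by (simp add: charpoly2_def det_2 trace_def sum_2)

text \<open>The value of that polynomial at a square matrix. Here \<open>mat c\<close> is the scalar matrix
  \<open>c I\<close>; the library has no evaluation of polynomials at matrices of type \<open>'a ^ 'n ^ 'n\<close>.\<close>

definition charpoly2_at :: "'a::field ^ 2 ^ 2 \<Rightarrow> 'a ^ 'n ^ 'n \<Rightarrow> 'a ^ 'n ^ 'n" where
  "charpoly2_at L A = (A - mat (L$1$1)) ** (A - mat (L$2$2)) - mat (L$1$2 * L$2$1)"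

end

theory Submission
  imports Defs
begin

text \<open>By Cayley--Hamilton for \<open>L\<close>, the matrix \<open>p\<^sub>L(A)\<close> annihilates every
  super-eigenvector with super-eigenvalue \<open>L\<close>. Hence a proper one makes \<open>p\<^sub>L(A)\<close> singular, and
  a factorization \<open>p\<^sub>L = (T - c)(T - d)\<close> would make \<open>u\<close> or \<open>(A - d) u\<close> an eigenvector.
  Conversely, let \<open>p\<^sub>L\<close> be irreducible and let \<open>u\<close> be a nonzero vector in the kernel of
  \<open>p\<^sub>L(A)\<close>. Then \<open>q \<noteq> 0\<close>, and \<open>u\<close> together with \<open>v = (A u - p u) / q\<close> spans the desired
  plane; an eigenvector in the kernel of \<open>p\<^sub>L(A)\<close> would have a root of \<open>p\<^sub>L\<close> as its
  eigenvalue.\<close>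

text \<open>A nontrivial factorization of a quadratic has two linear factors, and over a field each
  linear factor has a root.\<close>

lemma irreducible_degree_2_iff:
  fixes p :: "'a::field poly"
  assumes "degree p = 2"
  shows "irreducible p \<longleftrightarrow> (\<forall>x. poly p x \<noteq> 0)"
proof
  assume irr: "irreducible p"
  show "\<forall>x. poly p x \<noteq> 0"
  proof (intro allI notI)
    fix x assume "poly p x = 0"
    then obtain r where r: "p = [:-x, 1:] * r"
      by (auto simp: poly_eq_0_iff_dvd elim: dvdE)
    have "r \<noteq> 0" using r assms by auto
    then have "degree r = 1" using r assms by (simp add: degree_mult_eq del: mult_pCons_left)
    moreover have "[:-x, 1:] dvd 1 \<or> r dvd 1" using irreducibleD[OF irr r] .
    ultimately show False using \<open>r \<noteq> 0\<close> by (auto simp: is_unit_iff_degree)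
  qed
next
  assume no_root: "\<forall>x. poly p x \<noteq> 0"
  have no_linear: "degree a \<noteq> 1" if "a dvd p" for a
  proof
    assume "degree a = 1"
    then obtain b c where a: "a = [:b, c:]" and c: "c \<noteq> 0"
      by (cases a) (auto split: if_splits elim: degree_eq_zeroE)
    then have "poly a (- b / c) = 0" by simp
    with that have "poly p (- b / c) = 0" by (auto elim: dvdE)
    with no_root show False by blast
  qed
  show "irreducible p"
  proof (rule irreducibleI)
    show "p \<noteq> 0" using assms by auto
    then show "\<not> p dvd 1" using assms by (simp add: is_unit_iff_degree)
    fix a b assume ab: "p = a * b"
    have nz: "a \<noteq> 0" "b \<noteq> 0" using ab \<open>p \<noteq> 0\<close> by auto
    have "degree a + degree b = 2" using assms ab nz by (simp add: degree_mult_eq)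
    moreover have "degree a \<noteq> 1" "degree b \<noteq> 1" using no_linear ab by auto
    ultimately have "degree a = 0 \<or> degree b = 0" by linarith
    then show "a dvd 1 \<or> b dvd 1" using nz by (simp add: is_unit_iff_degree)
  qed
qed

lemma irreducible_charpoly2_iff:
  "irreducible (charpoly2 L) \<longleftrightarrow> (\<forall>c. (c - L$1$1) * (c - L$2$2) \<noteq> L$1$2 * L$2$1)"
proof -
  have "degree (charpoly2 L) = 2"
    by (simp add: charpoly2_trace_det)
  moreover have "poly (charpoly2 L) c = (c - L$1$1) * (c - L$2$2) - L$1$2 * L$2$1" for c
    by (simp add: charpoly2_def algebra_simps)
  ultimately show ?thesis
    by (simp add: irreducible_degree_2_iff)
qed

lemma singular_iff_kernel:
  fixes M :: "'a::field ^ 'n ^ 'n"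
  shows "det M = 0 \<longleftrightarrow> (\<exists>x. x \<noteq> 0 \<and> M *v x = 0)"
  using invertible_det_nz[of M] matrix_left_invertible_ker[of M]
  by (auto simp: invertible_left_inverse)

lemma mat_mult_vec: "mat c *v x = c *s x"
  by (simp add: vec_eq_iff matrix_vector_mult_def mat_def if_distrib[of "\<lambda>y. y * _"] cong: if_cong)

text \<open>Once the matrix product is expanded on a vector, the later identities reduce to ring
  arithmetic in each coordinate.\<close>

lemma charpoly2_at_mult_vec:
  "charpoly2_at L A *v x = A *v (A *v x) - (L$1$1 + L$2$2) *s (A *v x)
     + (L$1$1 * L$2$2 - L$1$2 * L$2$1) *s x"
  unfolding charpoly2_at_def matrix_vector_mult_diff_rdistrib matrix_vector_mul_assoc[symmetric]
    mat_mult_vec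
  by (simp add: vec.diff vec.scale vec_eq_iff algebra_simps)

text \<open>The scalar is the value of \<open>charpoly2 L\<close> at \<open>c\<close>, so an
  eigenvector in the kernel yields a root.\<close>

lemma charpoly2_at_eigenvector:
  assumes "A *v x = c *s x"
  shows "charpoly2_at L A *v x = ((c - L$1$1) * (c - L$2$2) - L$1$2 * L$2$1) *s x"
  by (simp add: charpoly2_at_mult_vec assms vec.scale vec_eq_iff algebra_simps)

text \<open>On the pair \<open>u\<close>, \<open>v\<close> the matrix \<open>A\<close> acts through
  the rows of \<open>L\<close>, so this is Cayley--Hamilton for \<open>L\<close>. Independence of
  the pair plays no part in the computation, which also allows its use for a constructed
  \<open>v\<close>.\<close>

lemma charpoly2_at_super_eigenvector:
  assumes u: "A *v u = L$1$1 *s u + L$1$2 *s v"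
    and v: "A *v v = L$2$1 *s u + L$2$2 *s v"
  shows "charpoly2_at L A *v u = 0" and "charpoly2_at L A *v v = 0"
  by (simp_all add: charpoly2_at_mult_vec u v vec.add vec.scale vec_eq_iff algebra_simps)

lemma span_2_iff: "x \<in> vec.span {u, v} \<longleftrightarrow> (\<exists>a b. x = a *s u + b *s v)"
  unfolding vec.span_breakdown_eq[of x u] vec.span_singleton image_iff
  by (simp add: diff_eq_eq add.commute)

lemma invariant_span_2:
  assumes "A *v u \<in> vec.span {u, v}" and "A *v v \<in> vec.span {u, v}"
    and "w \<in> vec.span {u, v}"
  shows "A *v w \<in> vec.span {u, v}"
  using assms(3) by (auto simp: span_2_iff[of w] vec.add vec.scale
      intro!: vec.span_add vec.span_scale assms(1,2))

lemma proper_super_eigenvalue_imp_singular_irreducible: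
  assumes "proper_super_eigenvalue A L"
  shows "det (charpoly2_at L A) = 0 \<and> irreducible (charpoly2 L)"
proof -
  obtain u v W where W: "vec.subspace W" "\<And>w. w \<in> W \<Longrightarrow> A *v w \<in> W"
    and no_eigenvector: "\<And>w. w \<in> W \<Longrightarrow> \<not> eigenvector A w"
    and ind: "vec.independent {u, v}" and span: "vec.span {u, v} = W"
    and u: "A *v u = L$1$1 *s u + L$1$2 *s v"
    and v: "A *v v = L$2$1 *s u + L$2$2 *s v"
    using assms
    unfolding proper_super_eigenvalue_def proper_super_eigenvector_def
      super_eigenvector_def super_eigenvalue_of_def
    by blast
  have "u \<in> W" using span by (auto intro: vec.span_base)
  have "u \<noteq> 0" using ind vec.dependent_zero[of "{u, v}"] by auto
  note ker = charpoly2_at_super_eigenvector(1)[OF u v]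
  have "irreducible (charpoly2 L)"
    unfolding irreducible_charpoly2_iff
  proof (intro allI notI)
    fix c assume root: "(c - L$1$1) * (c - L$2$2) = L$1$2 * L$2$1"
    \<comment> \<open>By Vieta, \<open>d\<close> is the other root, so
      \<open>charpoly2_at L A\<close> acts as \<open>(A - c)(A - d)\<close>, and
      \<open>y = (A - d) u\<close> is killed by \<open>A - c\<close>.\<close>
    define d where "d = L$1$1 + L$2$2 - c"
    define y where "y = A *v u - d *s u"
    have cd: "L$1$1 * L$2$2 - L$1$2 * L$2$1 = c * d"
      unfolding root[symmetric] d_def by (simp add: algebra_simps)
    have tr: "L$1$1 + L$2$2 = c + d" by (simp add: d_def)
    have "A *v y - c *s y = charpoly2_at L A *v u"
      unfolding charpoly2_at_mult_vec y_def cd tr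
      by (simp add: vec.diff vec.scale vec_eq_iff algebra_simps)
    then have "A *v y = c *s y" using ker by simp
    moreover have "y \<in> W"
      unfolding y_def using W \<open>u \<in> W\<close> by (intro vec.subspace_diff vec.subspace_scale)
    ultimately have "y = 0" using no_eigenvector by (auto simp: eigenvector_def)
    then have "A *v u = d *s u" by (simp add: y_def)
    with \<open>u \<in> W\<close> \<open>u \<noteq> 0\<close> no_eigenvector show False by (auto simp: eigenvector_def)
  qed
  with ker \<open>u \<noteq> 0\<close> show ?thesis by (auto simp: singular_iff_kernel)
qed

lemma singular_irreducible_imp_proper_super_eigenvalue:
  fixes A :: "'a::field ^ 'n ^ 'n"
  assumes "det (charpoly2_at L A) = 0" and "irreducible (charpoly2 L)"
  shows "proper_super_eigenvalue A L"
proof -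
  have no_root: "(c - L$1$1) * (c - L$2$2) \<noteq> L$1$2 * L$2$1" for c
    using assms(2) by (simp add: irreducible_charpoly2_iff)
  have no_eigenvector: "\<not> eigenvector A x" if "charpoly2_at L A *v x = 0" for x
  proof
    assume "eigenvector A x"
    then obtain c where "x \<noteq> 0" and c: "A *v x = c *s x" by (auto simp: eigenvector_def)
    then show False
      using that no_root[of c] by (simp add: charpoly2_at_eigenvector[OF c])
  qed
  obtain u where "u \<noteq> 0" and ker: "charpoly2_at L A *v u = 0"
    using assms(1) by (auto simp: singular_iff_kernel)
  \<comment> \<open>If this entry vanished, \<open>L\<close> would be triangular and
    \<open>L$1$1\<close> a root.\<close>
  have q: "L$1$2 \<noteq> 0" using no_root[of "L$1$1"] by auto
  \<comment> \<open>The first row of \<open>L\<close> forces this choice of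
    \<open>v\<close>.\<close>
  define v where "v = (1 / L$1$2) *s (A *v u - L$1$1 *s u)"
  have u: "A *v u = L$1$1 *s u + L$1$2 *s v"
    using q by (simp add: v_def)
  have v: "A *v v = L$2$1 *s u + L$2$2 *s v"
  proof -
    \<comment> \<open>Inserting \<open>A u = p u + q v\<close> into the kernel equation for
      \<open>u\<close> leaves \<open>q\<close> times the defect in the second row, and
      \<open>q\<close> cancels.\<close>
    have "L$1$2 *s (A *v v - (L$2$1 *s u + L$2$2 *s v)) = charpoly2_at L A *v u"
      unfolding charpoly2_at_mult_vec u
      by (simp add: u vec.add vec.scale vec_eq_iff algebra_simps)
    with ker q show ?thesis by (metis vec.scale_eq_0_iff right_minus_eq)
  qed
  \<comment> \<open>Otherwise \<open>u\<close> itself would be an eigenvector in the kernel.\<close>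
  have notin: "v \<notin> vec.span {u}"
  proof
    assume "v \<in> vec.span {u}"
    then obtain k where "v = k *s u" by (auto simp: vec.span_singleton)
    then have "A *v u = (L$1$1 + L$1$2 * k) *s u"
      by (simp add: u vec.scale_left_distrib)
    with \<open>u \<noteq> 0\<close> have "eigenvector A u" unfolding eigenvector_def by blast
    with no_eigenvector ker show False by blast
  qed
  then have "u \<noteq> v" using vec.span_base[of u "{u}"] by auto
  have ind: "vec.independent {u, v}"
    using vec.independent_insertI[OF notin] \<open>u \<noteq> 0\<close> by (simp add: insert_commute)
  have "A *v w \<in> vec.span {u, v}" if "w \<in> vec.span {u, v}" for w
    using that by (rule invariant_span_2[rotated 2]) (use u v in \<open>auto simp: span_2_iff\<close>)
  moreover have "vec.dim (vec.span {u, v}) = 2"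
    using vec.dim_span_eq_card_independent[OF ind] \<open>u \<noteq> v\<close> by simp
  ultimately have super: "super_eigenvector A (vec.span {u, v})"
    by (simp add: super_eigenvector_def)
  \<comment> \<open>The whole plane lies in the kernel, where \<open>no_eigenvector\<close>
    applies.\<close>
  have "charpoly2_at L A *v w = 0" if "w \<in> vec.span {u, v}" for w
    using that charpoly2_at_super_eigenvector[OF u v]
    by (auto simp: span_2_iff vec.add vec.scale)
  with super no_eigenvector have "proper_super_eigenvector A (vec.span {u, v})"
    by (auto simp: proper_super_eigenvector_def)
  moreover have "super_eigenvalue_of A (vec.span {u, v}) L"
    unfolding super_eigenvalue_of_def using super \<open>u \<noteq> v\<close> ind u v by blast
  ultimately show ?thesis by (auto simp: proper_super_eigenvalue_def)
qed

theorem theorem3p4: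
  fixes A :: "'a::field ^ 'n ^ 'n" and L :: "'a ^ 2 ^ 2"
  assumes "CHAR('a) \<noteq> 2"
  shows "proper_super_eigenvalue A L \<longleftrightarrow>
           det (charpoly2_at L A) = 0 \<and> irreducible (charpoly2 L)"
  using proper_super_eigenvalue_imp_singular_irreducible
    singular_irreducible_imp_proper_super_eigenvalue by blast

end
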